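(* Let $N\ge 1$, let $\mathbf{J}=\mathbf{I}+\mathbf{R}$ be a real symmetric positive definite $N\times N$ matrix with $\mathrm{diag}(\mathbf{R})=\mathbf{0}$, let $\mathbf{h}\in\mathbb{R}^N$, and assume the graph $G$ on $\{1,\dots,N\}$ with edge set $E=\{\{i,j\}: i\neq j,\ R_{ij}\neq 0\}$ is connected. For $\boldsymbol{\alpha}=(\alpha_{ij})_{\{i,j\}\in E}$ with all $\alpha_{ij}>0$ (written $\boldsymbol{\alpha}>\mathbf{0}$), let $F_{\boldsymbol{\alpha}}$ be the Gaussian fractional Bethe free energy (defined in the context). Let $|\mathbf{R}|$ be the matrix with entries $|R_{ij}|$ and $\lambda_{max}(|\mathbf{R}|)$ its largest eigenvalue. Then: (1) if $\lambda_{max}(|\mathbf{R}|)<1$, then $F_{\boldsymbol{\alpha}}$ is bounded from below for all $\boldsymbol{\alpha}>\mathbf{0}$; (2) if $\lambda_{max}(|\mathbf{R}|)>1$, then $F_{\boldsymbol{\alpha}}$ is unbounded from below for all $\boldsymbol{\alpha}>\mathbf{0}$; (3) if $\lambda_{max}(|\mathbf{R}|)=1$, then (for $\boldsymbol{\alpha}>\mathbf{0}$) $F_{\boldsymbol{\alpha}}$ is bounded from below if and only if $$\frac12\sum_{i=1}^N\ \sum_{j:\{i,j\}\in E}\frac{1}{\alpha_{ij}}\ \ge\ N .$$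
   Context: The Gaussian fractional Bethe free energy is the function of $\mathbf{m}\in\mathbb{R}^N$ and $\boldsymbol{\Sigma}$, where $\boldsymbol{\Sigma}$ consists of numbers $\sigma_k>0$ ($k=1,\dots,N$) and, for each edge $\{i,j\}\in E$, a number $\sigma_{ij}=\sigma_{ji}$ with $|\sigma_{ij}|<\sigma_i\sigma_j$ (so that each $2\times2$ matrix with diagonal $\sigma_i^2,\sigma_j^2$ and off-diagonal $\sigma_{ij}$ is a covariance matrix; no joint positive definiteness is required), given by $$F_{\boldsymbol{\alpha}}(\mathbf{m},\boldsymbol{\Sigma})=-\mathbf{h}^T\mathbf{m}+\frac12\mathbf{m}^T\mathbf{J}\mathbf{m}+\frac12\sum_{k}\sigma_k^2+\sum_{\{i,j\}\in E}R_{ij}\sigma_{ij}-\frac12\sum_{\{i,j\}\in E}\frac1{\alpha_{ij}}\log\Bigl(1-\frac{\sigma_{ij}^2}{\sigma_i^2\sigma_j^2}\Bigr)-\sum_k\log\sigma_k+C,$$ where $C$ is a constant not depending on $(\mathbf{m},\boldsymbol{\Sigma})$. The terms $\frac12\sum_k\sigma_k^2+\sum_{\{i,j\}\in E}R_{ij}\sigma_{ij}$ equal $\frac12\mathrm{Tr}(\mathbf{J}^T\boldsymbol{\Sigma})$, where $\boldsymbol{\Sigma}$ is viewed as the matrix with diagonal entries $\sigma_k^2$ and off-diagonal entries $\sigma_{ij}$. Sums over $E$ count each unordered edge once. Bounded from below means bounded from below on this whole domain of $(\mathbf{m},\boldsymbol{\Sigma})$. The numbers satisfy $\alpha_{ij}=\alpha_{ji}$.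 *)

theory Defs
  imports "HOL-Analysis.Analysis"
begin

definition positive_definite :: "real^'n^'n \<Rightarrow> bool" where
  "positive_definite A \<longleftrightarrow> transpose A = A \<and> (\<forall>x. x \<noteq> 0 \<longrightarrow> 0 < x \<bullet> (A *v x))"

definition eigenvalues :: "real^'n^'n \<Rightarrow> real set" where
  "eigenvalues A = {l. \<exists>v. v \<noteq> 0 \<and> A *v v = l *\<^sub>R v}"

(* For symmetric A the set of real eigenvalues is finite and nonempty, so Max is meaningful. *)
definition lambda_max :: "real^'n^'n \<Rightarrow> real" where
  "lambda_max A = Max (eigenvalues A)"

definition abs_matrix :: "real^'n^'m \<Rightarrow> real^'n^'m" where
  "abs_matrix A = (\<chi> i j. \<bar>A $ i $ j\<bar>)"

definition edges :: "real^'n^'n \<Rightarrow> 'n set set" where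
  "edges R = {{i, j} | i j. i \<noteq> j \<and> R $ i $ j \<noteq> 0}"

definition connected_graph :: "'n set set \<Rightarrow> bool" where
  "connected_graph E \<longleftrightarrow> (\<forall>i j. (i, j) \<in> {(i, j). {i, j} \<in> E}\<^sup>*)"

(* Sum over unordered edges: the double sum meets each edge twice, once per orientation.
   It is only applied to f with f i j = f j i on edges. *)
definition edge_sum :: "('n::finite) set set \<Rightarrow> ('n \<Rightarrow> 'n \<Rightarrow> real) \<Rightarrow> real" where
  "edge_sum E f = (\<Sum>i\<in>UNIV. \<Sum>j | {i, j} \<in> E. f i j) / 2"

lemma edge_sum_unordered:
  fixes R :: "real^'n^'n"
  assumes "\<And>i j. {i, j} \<in> edges R \<Longrightarrow> f i j = g {i, j}"
  shows "edge_sum (edges R) f = (\<Sum>e\<in>edges R. g e)"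
proof -
  let ?P = "{(i, j). {i, j} \<in> edges R}"
  have "(\<Sum>i\<in>UNIV. \<Sum>j | {i, j} \<in> edges R. f i j) = (\<Sum>(i, j)\<in>?P. f i j)"
    by (subst sum.Sigma) (auto intro!: sum.cong)
  also have "\<dots> = (\<Sum>p\<in>?P. g {fst p, snd p})"
    using assms by (auto intro!: sum.cong)
  also have "\<dots> = (\<Sum>e\<in>edges R. \<Sum>p | p \<in> ?P \<and> {fst p, snd p} = e. g {fst p, snd p})"
    by (rule sum.group[symmetric]) auto
  also have "\<dots> = (\<Sum>e\<in>edges R. 2 * g e)"
  proof (rule sum.cong[OF refl])
    fix e assume e: "e \<in> edges R"
    then obtain a b where ab: "e = {a, b}" "a \<noteq> b" unfolding edges_def by blast
    have "{p. p \<in> ?P \<and> {fst p, snd p} = e} = {(a, b), (b, a)}"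
      using e ab by (auto simp: doubleton_eq_iff insert_commute)
    then show "(\<Sum>p | p \<in> ?P \<and> {fst p, snd p} = e. g {fst p, snd p}) = 2 * g e"
      using ab by (simp add: insert_commute)
  qed
  finally show ?thesis by (simp add: edge_sum_def sum_distrib_left[symmetric])
qed

(* A point is (m, s, c): s $ k is the standard deviation sigma_k, and c {i, j} the covariance
   sigma_ij.  Indexing c (and alpha below) by unordered edges builds in the symmetry in i and j;
   the values of c and alpha outside the edge set are never used. *)
definition bethe_domain ::
    "real^'n^'n \<Rightarrow> ((real^'n) \<times> (real^'n) \<times> ('n set \<Rightarrow> real)) set" where
  "bethe_domain R = {(m, s, c). (\<forall>k. 0 < s $ k) \<and>
     (\<forall>i j. {i, j} \<in> edges R \<longrightarrow> \<bar>c {i, j}\<bar> < s $ i * s $ j)}"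

definition bethe_energy ::
    "real^'n \<Rightarrow> real^'n^'n \<Rightarrow> real \<Rightarrow> ('n set \<Rightarrow> real) \<Rightarrow>
     (real^'n) \<times> (real^'n) \<times> ('n set \<Rightarrow> real) \<Rightarrow> real" where
  "bethe_energy h R C \<alpha> = (\<lambda>(m, s, c).
     - (h \<bullet> m) + 1 / 2 * (m \<bullet> ((mat 1 + R) *v m))
     + 1 / 2 * (\<Sum>k\<in>UNIV. (s $ k)\<^sup>2)
     + edge_sum (edges R) (\<lambda>i j. R $ i $ j * c {i, j})
     - 1 / 2 * edge_sum (edges R)
         (\<lambda>i j. 1 / \<alpha> {i, j} * ln (1 - (c {i, j})\<^sup>2 / ((s $ i)\<^sup>2 * (s $ j)\<^sup>2)))
     - (\<Sum>k\<in>UNIV. ln (s $ k)) + C)"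

definition bounded_from_below ::
    "real^'n \<Rightarrow> real^'n^'n \<Rightarrow> real \<Rightarrow> ('n set \<Rightarrow> real) \<Rightarrow> bool" where
  "bounded_from_below h R C \<alpha> \<longleftrightarrow> bdd_below (bethe_energy h R C \<alpha> ` bethe_domain R)"

end

theory Submission
  imports Defs
begin

text \<open>
  Write \<open>A\<close> for the matrix of absolute values of \<open>R\<close> and \<open>\<beta> = 1 / \<alpha>\<close>.  The correlation terms of
  the energy are at least \<open>- A\<^sub>i\<^sub>j s\<^sub>i s\<^sub>j\<close>, so the energy is at least
  \<open>(s \<bullet> s - s \<bullet> A s) / 2 - \<Sum> ln s\<^sub>k\<close> up to a constant, which settles the case below 1.  Above 1, take a
  positive \<open>s\<close> near a nonnegative top eigenvector and correlations \<open>- (1 - \<delta>) sgn R\<^sub>i\<^sub>j\<close>: the energy goes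
  to minus infinity quadratically along the ray through \<open>s\<close>.

  In the critical case let \<open>u\<close> be the positive Perron vector and \<open>B\<close> the sum of \<open>\<beta>\<close> over the edges.
  Along \<open>s = t u\<close> with \<open>\<delta> = t\<^sup>-\<^sup>2\<close> the energy is at most \<open>(B - N) ln t\<close> plus a constant for \<open>t \<ge> 1\<close>.
  Conversely, optimising the correlations turns the edge terms into \<open>(\<beta>\<^sub>i\<^sub>j / 2) ln (s\<^sub>i s\<^sub>j)\<close>, which gives
  \<open>B ln t\<close> when all \<open>s\<^sub>i / u\<^sub>i\<close> are comparable to \<open>t\<close>; when they are not, the quadratic form, which
  equals \<open>\<Sum> A\<^sub>i\<^sub>j u\<^sub>i u\<^sub>j (s\<^sub>i / u\<^sub>i - s\<^sub>j / u\<^sub>j)\<^sup>2\<close> over the edges, dominates by connectedness.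
\<close>

section \<open>Symmetric matrices and the Rayleigh quotient\<close>

lemma symmetric_matrix_entry:
  assumes "transpose A = A"
  shows "A $ i $ j = A $ j $ i"
  using assms by (metis (no_types, lifting) transpose_def vec_lambda_beta)

lemma symmetric_matrix_inner:
  fixes A :: "real^'n^'n"
  assumes "transpose A = A"
  shows "x \<bullet> (A *v y) = (A *v x) \<bullet> y"
  by (metis assms dot_lmul_matrix transpose_matrix_vector)

text \<open>At a zero \<open>v\<close> of a nonnegative form the first variation vanishes: in
  direction \<open>w = B *v v\<close> it is \<open>2 * (w \<bullet> w)\<close>, so for nonzero
  \<open>w\<close> a short move against \<open>w\<close> would make the form negative.\<close>

lemma psd_null_vector:
  fixes B :: "real^'n^'n"
  assumes sym: "transpose B = B" and psd: "\<And>x. 0 \<le> x \<bullet> (B *v x)" and v: "v \<bullet> (B *v v) = 0"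
  shows "B *v v = 0"
proof (rule ccontr)
  define w where "w = B *v v"
  define b where "b = w \<bullet> (B *v w)"
  \<comment> \<open>The minimiser on the line would be \<open>- (w \<bullet> w) / b\<close>; the
    denominator \<open>b + 1\<close> covers \<open>b = 0\<close> and still gives a negative
    value.\<close>
  define t where "t = - (w \<bullet> w) / (b + 1)"
  assume "B *v v \<noteq> 0"
  then have a: "w \<bullet> w > 0" by (simp add: w_def)
  have b: "b \<ge> 0" by (simp add: b_def psd)
  have "0 \<le> (v + t *\<^sub>R w) \<bullet> (B *v (v + t *\<^sub>R w))" by (rule psd)
  also have "\<dots> = v \<bullet> (B *v v) + t * (v \<bullet> (B *v w)) + t * (w \<bullet> (B *v v)) + t * t * b"
    by (simp add: b_def matrix_vector_right_distrib matrix_vector_mult_scaleR inner_add_left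
        inner_add_right algebra_simps)
  also have "v \<bullet> (B *v w) = w \<bullet> w"
    by (simp add: symmetric_matrix_inner[OF sym] w_def)
  also have "w \<bullet> (B *v v) = w \<bullet> w" by (simp add: w_def)
  finally have "0 \<le> t * (2 * (w \<bullet> w) + t * b)" using v by (simp add: algebra_simps)
  moreover have "t < 0" using a b by (simp add: t_def divide_neg_pos)
  ultimately have le: "2 * (w \<bullet> w) + t * b \<le> 0" by (simp add: zero_le_mult_iff)
  have "t * b = - (w \<bullet> w) * (b / (b + 1))" by (simp add: t_def)
  moreover have "(w \<bullet> w) * (b / (b + 1)) \<le> (w \<bullet> w) * 1"
    using a b by (intro mult_left_mono) auto
  ultimately show False using le a by simp
qed

text \<open>One eigenvector per eigenvalue gives pairwise orthogonal nonzero vectors, which are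
  independent and so finitely many.\<close>

lemma finite_eigenvalues_symmetric:
  fixes A :: "real^'n^'n"
  assumes sym: "transpose A = A"
  shows "finite (eigenvalues A)"
proof -
  have "\<forall>l\<in>eigenvalues A. \<exists>v. v \<noteq> 0 \<and> A *v v = l *\<^sub>R v" by (auto simp: eigenvalues_def)
  then obtain f where f: "\<And>l. l \<in> eigenvalues A \<Longrightarrow> f l \<noteq> 0 \<and> A *v f l = l *\<^sub>R f l"
    by metis
  have orth: "f l \<bullet> f k = 0" if "l \<in> eigenvalues A" "k \<in> eigenvalues A" "l \<noteq> k" for l k
  proof -
    have "k * (f l \<bullet> f k) = l * (f l \<bullet> f k)"
      using symmetric_matrix_inner[OF sym, of "f l" "f k"] f[OF that(1)] f[OF that(2)] by simp
    then show ?thesis using that(3) by simp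
  qed
  have "pairwise orthogonal (f ` eigenvalues A)"
    using orth by (auto simp: pairwise_def orthogonal_def)
  moreover have "0 \<notin> f ` eigenvalues A" using f by auto
  ultimately have "finite (f ` eigenvalues A)"
    by (intro independent_imp_finite pairwise_orthogonal_independent)
  moreover have "inj_on f (eigenvalues A)"
    by (intro inj_onI) (metis f orth inner_eq_zero_iff)
  ultimately show ?thesis by (rule finite_imageD)
qed

text \<open>A maximiser \<open>v\<close> of the form on the unit sphere, with value
  \<open>\<mu>\<close>, is a zero of the positive semidefinite form of
  \<open>\<mu> *\<^sub>R mat 1 - A\<close>, hence an eigenvector. So \<open>\<mu>\<close> is at most
  \<open>lambda_max A\<close>, and the Rayleigh bound for \<open>\<mu>\<close> carries over.\<close>

lemma lambda_max_symmetric: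
  fixes A :: "real^'n^'n"
  assumes sym: "transpose A = A"
  shows lambda_max_eigenvalue: "lambda_max A \<in> eigenvalues A"
    and rayleigh_le_lambda_max: "\<And>x. x \<bullet> (A *v x) \<le> lambda_max A * (x \<bullet> x)"
proof -
  have "\<exists>v\<in>sphere 0 1. \<forall>x\<in>sphere 0 1. x \<bullet> (A *v x) \<le> v \<bullet> (A *v v)"
    by (intro continuous_attains_sup) (auto intro!: continuous_intros matrix_vector_mult_linear_continuous_on)
  then obtain v :: "real^'n" where v: "norm v = 1"
    and max: "\<And>x. norm x = 1 \<Longrightarrow> x \<bullet> (A *v x) \<le> v \<bullet> (A *v v)" by auto
  define \<mu> where "\<mu> = v \<bullet> (A *v v)"
  have ray: "x \<bullet> (A *v x) \<le> \<mu> * (x \<bullet> x)" for x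
  proof (cases "x = 0")
    case False
    have "(inverse (norm x) *\<^sub>R x) \<bullet> (A *v (inverse (norm x) *\<^sub>R x)) \<le> \<mu>"
      unfolding \<mu>_def by (rule max) (use False in simp)
    then have "x \<bullet> (A *v x) / (norm x)\<^sup>2 \<le> \<mu>"
      by (simp add: matrix_vector_mult_scaleR power2_eq_square divide_inverse mult_ac)
    then show ?thesis using False by (simp add: power2_norm_eq_inner pos_divide_le_eq)
  qed simp
  define B where "B = \<mu> *\<^sub>R mat 1 - A"
  have B: "B *v x = \<mu> *\<^sub>R x - A *v x" for x
    by (simp add: B_def matrix_vector_mult_diff_rdistrib scaleR_matrix_vector_assoc[symmetric])
  have "transpose B = B"
    using sym by (simp add: B_def transpose_def vec_eq_iff mat_def)
  then have "B *v v = 0"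
    by (rule psd_null_vector)
      (use ray v in \<open>auto simp: B inner_diff_right \<mu>_def power2_norm_eq_inner[symmetric]\<close>)
  then have "\<mu> \<in> eigenvalues A" using v by (auto simp: B eigenvalues_def intro!: exI[of _ v])
  then have "\<mu> \<le> lambda_max A" and "eigenvalues A \<noteq> {}"
    by (auto simp: lambda_max_def finite_eigenvalues_symmetric[OF sym])
  then show "lambda_max A \<in> eigenvalues A"
    by (simp add: lambda_max_def finite_eigenvalues_symmetric[OF sym])
  show "x \<bullet> (A *v x) \<le> lambda_max A * (x \<bullet> x)" for x
    using ray[of x] mult_right_mono[OF \<open>\<mu> \<le> lambda_max A\<close>, of "x \<bullet> x"] by simp
qed

section \<open>Nonnegative symmetric matrices\<close>

lemma inner_matrix_vector:
  fixes A :: "real^'n^'n"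
  shows "x \<bullet> (A *v y) = (\<Sum>i\<in>UNIV. \<Sum>j\<in>UNIV. A $ i $ j * x $ i * y $ j)"
  by (simp add: inner_vec_def matrix_vector_mult_def sum_distrib_left mult_ac)

lemma inner_abs_vector_ge:
  fixes A :: "real^'n^'n"
  assumes "\<And>i j. 0 \<le> A $ i $ j"
  shows "v \<bullet> (A *v v) \<le> (\<chi> i. \<bar>v $ i\<bar>) \<bullet> (A *v (\<chi> i. \<bar>v $ i\<bar>))"
  unfolding inner_matrix_vector
proof (intro sum_mono)
  fix i j
  have "v $ i * v $ j \<le> \<bar>v $ i\<bar> * \<bar>v $ j\<bar>" by (metis abs_ge_self abs_mult)
  then have "A $ i $ j * (v $ i * v $ j) \<le> A $ i $ j * (\<bar>v $ i\<bar> * \<bar>v $ j\<bar>)"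
    by (rule mult_left_mono[OF _ assms])
  then show "A $ i $ j * v $ i * v $ j
    \<le> A $ i $ j * (\<chi> i. \<bar>v $ i\<bar>) $ i * (\<chi> i. \<bar>v $ i\<bar>) $ j"
    by (simp add: mult.assoc)
qed

text \<open>Taking absolute values in a top eigenvector keeps its norm and cannot lower the form, so
  the Rayleigh bound is attained.\<close>

lemma nonneg_top_vector:
  fixes A :: "real^'n^'n"
  assumes sym: "transpose A = A" and nonneg: "\<And>i j. 0 \<le> A $ i $ j"
  obtains w where "w \<noteq> 0" "\<And>i. 0 \<le> w $ i" "w \<bullet> (A *v w) = lambda_max A * (w \<bullet> w)"
proof -
  obtain v where v: "v \<noteq> 0" "A *v v = lambda_max A *\<^sub>R v"
    using lambda_max_eigenvalue[OF sym] by (auto simp: eigenvalues_def)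
  define w where "w = (\<chi> i. \<bar>v $ i\<bar>)"
  have ww: "w \<bullet> w = v \<bullet> v" by (simp add: w_def inner_vec_def)
  have "lambda_max A * (w \<bullet> w) \<le> w \<bullet> (A *v w)"
    using inner_abs_vector_ge[OF nonneg, of v] v by (simp add: ww w_def[symmetric])
  moreover have "w \<bullet> (A *v w) \<le> lambda_max A * (w \<bullet> w)"
    by (rule rayleigh_le_lambda_max[OF sym])
  moreover have "w \<noteq> 0" using v(1) by (auto simp: w_def vec_eq_iff)
  ultimately show thesis by (intro that[of w]) (auto simp: w_def)
qed

section \<open>Sums over edges\<close>

lemma mem_edges_iff:
  fixes R :: "real^'n^'n"
  assumes "transpose R = R" and "\<forall>i. R $ i $ i = 0"
  shows "{i, j} \<in> edges R \<longleftrightarrow> R $ i $ j \<noteq> 0"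
proof -
  have "R $ a $ b = R $ b $ a" for a b
    by (rule symmetric_matrix_entry[OF assms(1)])
  moreover have "i \<noteq> j" if "R $ i $ j \<noteq> 0" using assms(2) that by auto
  ultimately show ?thesis by (auto simp: edges_def doubleton_eq_iff)
qed

lemma edge_sum_mono:
  assumes "\<And>i j. {i, j} \<in> E \<Longrightarrow> f i j \<le> g i j"
  shows "edge_sum E f \<le> edge_sum E g"
  unfolding edge_sum_def by (intro divide_right_mono sum_mono) (auto intro: assms)

lemma edge_sum_cong:
  assumes "\<And>i j. {i, j} \<in> E \<Longrightarrow> f i j = g i j"
  shows "edge_sum E f = edge_sum E g"
  by (intro antisym edge_sum_mono) (simp_all add: assms)

lemma edge_sum_add: "edge_sum E (\<lambda>i j. f i j + g i j) = edge_sum E f + edge_sum E g"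
  by (simp add: edge_sum_def sum.distrib add_divide_distrib)

lemma edge_sum_mult_left: "edge_sum E (\<lambda>i j. k * f i j) = k * edge_sum E f"
  by (simp add: edge_sum_def sum_distrib_left)

lemma edge_sum_mult_right: "edge_sum E (\<lambda>i j. f i j * k) = edge_sum E f * k"
  by (simp add: edge_sum_def sum_distrib_right)

lemma edge_sum_diff: "edge_sum E (\<lambda>i j. f i j - g i j) = edge_sum E f - edge_sum E g"
  by (simp add: edge_sum_def sum_subtractf diff_divide_distrib)

text \<open>The quadratic form meets each edge in both orientations and has no other nonzero terms,
  hence the factor one half.\<close>

lemma edge_sum_abs_matrix:
  fixes R :: "real^'n^'n"
  assumes "transpose R = R" and "\<forall>i. R $ i $ i = 0"
  shows "edge_sum (edges R) (\<lambda>i j. \<bar>R $ i $ j\<bar> * (s $ i * s $ j))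
    = s \<bullet> (abs_matrix R *v s) / 2"
proof -
  have "(\<Sum>j | {i, j} \<in> edges R. \<bar>R $ i $ j\<bar> * (s $ i * s $ j))
    = (\<Sum>j\<in>UNIV. abs_matrix R $ i $ j * s $ i * s $ j)" for i
    by (intro sum.mono_neutral_cong_left) (auto simp: mem_edges_iff[OF assms] abs_matrix_def)
  then show ?thesis by (simp add: edge_sum_def inner_matrix_vector)
qed

section \<open>The positive Perron vector at the critical value\<close>

lemma transpose_abs_matrix:
  assumes "transpose R = R"
  shows "transpose (abs_matrix R) = abs_matrix R"
  using assms by (simp add: transpose_def abs_matrix_def vec_eq_iff)

text \<open>A nonnegative top vector is a zero of the positive semidefinite form of
  \<open>mat 1 - abs_matrix R\<close>, hence fixed by \<open>abs_matrix R\<close>. Its zeros spread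
  along edges, so by connectedness a single zero would make it vanish.\<close>

lemma perron_vector:
  fixes R :: "real^'n^'n"
  assumes sym: "transpose R = R" and diag: "\<forall>i. R $ i $ i = 0"
    and conn: "connected_graph (edges R)" and one: "lambda_max (abs_matrix R) = 1"
  obtains u where "\<And>i. 0 < u $ i" "abs_matrix R *v u = u"
proof -
  let ?A = "abs_matrix R"
  note symA = transpose_abs_matrix[OF sym]
  obtain w where w: "w \<noteq> 0" "\<And>i. 0 \<le> w $ i" "w \<bullet> (?A *v w) = lambda_max ?A * (w \<bullet> w)"
    by (rule nonneg_top_vector[OF symA]) (auto simp: abs_matrix_def)
  have "(mat 1 - ?A) *v w = 0"
  proof (rule psd_null_vector)
    show "transpose (mat 1 - ?A) = mat 1 - ?A"
      using symA by (simp add: transpose_def vec_eq_iff mat_def)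
    show "0 \<le> x \<bullet> ((mat 1 - ?A) *v x)" for x
      using rayleigh_le_lambda_max[OF symA, of x] one
      by (simp add: matrix_vector_mult_diff_rdistrib inner_diff_right)
  qed (use w(3) one in \<open>simp add: matrix_vector_mult_diff_rdistrib inner_diff_right\<close>)
  then have Aw: "?A *v w = w" by (simp add: matrix_vector_mult_diff_rdistrib)
  \<comment> \<open>Row \<open>i\<close> of the fixed point equation is a vanishing sum of
    nonnegative terms.\<close>
  have step: "w $ j = 0" if "w $ i = 0" "{i, j} \<in> edges R" for i j
  proof -
    have "(\<Sum>j\<in>UNIV. ?A $ i $ j * w $ j) = 0"
      using arg_cong[OF Aw, of "\<lambda>v. v $ i"] that(1) by (simp add: matrix_vector_mult_def)
    then have "?A $ i $ j * w $ j = 0"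
      by (subst (asm) sum_nonneg_eq_0_iff) (auto simp: w(2) abs_matrix_def)
    then show ?thesis using that(2) by (simp add: mem_edges_iff[OF sym diag] abs_matrix_def)
  qed
  have "w $ i \<noteq> 0" for i
  proof
    assume i: "w $ i = 0"
    have "w $ j = 0" for j
    proof -
      have "(i, j) \<in> {(i, j). {i, j} \<in> edges R}\<^sup>*"
        using conn by (simp add: connected_graph_def)
      then show ?thesis by induction (use i step in auto)
    qed
    then show False using w(1) by (simp add: vec_eq_iff)
  qed
  then show thesis by (intro that[OF _ Aw]) (simp add: w(2) less_le)
qed

section \<open>Elementary lower bounds\<close>

text \<open>Completing the square at the solution \<open>y\<close> of \<open>J *v y = h\<close>.
  This settles the mean, which is not coupled to the variances and covariances.\<close>

lemma pos_def_quadratic_bdd_below: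
  fixes J :: "real^'n^'n"
  assumes "positive_definite J"
  obtains K where "\<And>m. K \<le> - (h \<bullet> m) + 1 / 2 * (m \<bullet> (J *v m))"
proof -
  have sym: "transpose J = J" and pos: "\<And>x. x \<noteq> 0 \<Longrightarrow> 0 < x \<bullet> (J *v x)"
    using assms by (auto simp: positive_definite_def)
  have "inj ((*v) J)"
    unfolding linear_injective_0[OF matrix_vector_mul_linear]
    using pos by (metis inner_zero_right less_irrefl)
  then have "surj ((*v) J)" by (intro linear_injective_imp_surjective) auto
  then obtain y where y: "J *v y = h" by (metis surj_def)
  show thesis
  proof (rule that)
    fix m
    have "0 \<le> (m - y) \<bullet> (J *v (m - y))" using pos[of "m - y"] by (cases "m - y = 0") auto
    also have "\<dots> = m \<bullet> (J *v m) - m \<bullet> (J *v y) - y \<bullet> (J *v m) + y \<bullet> (J *v y)"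
      by (simp add: matrix_vector_mult_diff_distrib inner_diff_left inner_diff_right)
    also have "y \<bullet> (J *v m) = h \<bullet> m" by (simp add: symmetric_matrix_inner[OF sym] y)
    finally show "- (y \<bullet> h) / 2 \<le> - (h \<bullet> m) + 1 / 2 * (m \<bullet> (J *v m))"
      by (simp add: y inner_commute)
  qed
qed

text \<open>This is \<open>ln z \<le> z - 1\<close> at \<open>z = a / b * d\<close>, with equality
  at \<open>d = b / a\<close>. It serves both for variances and for the distance of a covariance
  from its limit.\<close>

lemma mult_ln_le:
  fixes a b d :: real
  assumes "0 < a" "0 < b" "0 < d"
  shows "b * ln d \<le> a * d - b * (1 + ln (a / b))"
proof -
  have "ln (a / b * d) \<le> a / b * d - 1" using assms by (intro ln_le_minus_one) simp
  then have "ln d \<le> a / b * d - 1 - ln (a / b)" using assms by (simp add: ln_mult ln_div)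
  then have "b * ln d \<le> b * (a / b * d - 1 - ln (a / b))" using assms by (intro mult_left_mono) auto
  also have "\<dots> = a * d - b * (1 + ln (a / b))" using assms by (simp add: field_simps)
  finally show ?thesis .
qed

lemma square_minus_ln_bdd_below:
  fixes a b :: real
  assumes "0 < a" "0 < b"
  obtains K where "\<And>x. 0 < x \<Longrightarrow> K \<le> a * x\<^sup>2 - b * ln x"
proof
  fix x :: real assume "0 < x"
  \<comment> \<open>The halves arise because \<open>ln (x\<^sup>2)\<close> is
    \<open>2 * ln x\<close>.\<close>
  then show "b / 2 * (1 + ln (a / (b / 2))) \<le> a * x\<^sup>2 - b * ln x"
    using mult_ln_le[of a "b / 2" "x\<^sup>2"] assms by (simp add: ln_realpow)
qed

section \<open>The critical quadratic form on a connected graph\<close>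

text \<open>Expanding the squares, \<open>A *v u = u\<close> turns each of the two square terms into
  \<open>s \<bullet> s\<close>. The form of \<open>mat 1 - A\<close> thus becomes a weighted graph
  Laplacian in the ratios \<open>s $ i / u $ i\<close>.\<close>

lemma ground_state_identity:
  fixes A :: "real^'n^'n"
  assumes sym: "transpose A = A" and u: "\<And>i. 0 < u $ i" and Au: "A *v u = u"
  shows "s \<bullet> s - s \<bullet> (A *v s)
    = (\<Sum>i\<in>UNIV. \<Sum>j\<in>UNIV. A $ i $ j * (u $ i * u $ j) * (s $ i / u $ i - s $ j / u $ j)\<^sup>2) / 2"
proof -
  have symA: "A $ i $ j = A $ j $ i" for i j
    by (rule symmetric_matrix_entry[OF sym])
  have row: "(\<Sum>j\<in>UNIV. A $ i $ j * u $ j) = u $ i" for i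
    using arg_cong[OF Au, of "\<lambda>v. v $ i"] by (simp add: matrix_vector_mult_def)
  have "(\<Sum>j\<in>UNIV. (s $ i)\<^sup>2 / u $ i * (A $ i $ j * u $ j)) = (s $ i)\<^sup>2" for i
    unfolding sum_distrib_left[symmetric] row using u[of i] by simp
  then have diag: "(\<Sum>i\<in>UNIV. \<Sum>j\<in>UNIV. (s $ i)\<^sup>2 / u $ i * (A $ i $ j * u $ j)) = s \<bullet> s"
    by (simp add: inner_vec_def power2_eq_square)
  have diag': "(\<Sum>i\<in>UNIV. \<Sum>j\<in>UNIV. (s $ j)\<^sup>2 / u $ j * (A $ j $ i * u $ i)) = s \<bullet> s"
    by (subst sum.swap) (rule diag)
  have cross: "(\<Sum>i\<in>UNIV. \<Sum>j\<in>UNIV. 2 * (A $ i $ j * s $ i * s $ j)) = 2 * (s \<bullet> (A *v s))"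
    by (simp add: inner_matrix_vector sum_distrib_left)
  have "A $ i $ j * (u $ i * u $ j) * (s $ i / u $ i - s $ j / u $ j)\<^sup>2
    = (s $ i)\<^sup>2 / u $ i * (A $ i $ j * u $ j) + (s $ j)\<^sup>2 / u $ j * (A $ j $ i * u $ i)
      - 2 * (A $ i $ j * s $ i * s $ j)" for i j
    using u[of i] u[of j] symA[of j i] by (simp add: power2_eq_square field_simps)
  then show ?thesis
    by (simp only: sum.distrib sum_subtractf diag diag' cross) simp
qed

text \<open>Each edge term is at most the whole sum, and a path joins any two vertices, so
  differences are controlled by induction along the path. There are finitely many pairs, so one
  constant suffices.\<close>

lemma graph_poincare:
  fixes w :: "'n::finite \<Rightarrow> 'n \<Rightarrow> real"
  assumes conn: "connected_graph E" and nonneg: "\<And>i j. 0 \<le> w i j"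
    and pos: "\<And>i j. {i, j} \<in> E \<Longrightarrow> 0 < w i j"
  obtains \<kappa> where "0 < \<kappa>"
    "\<And>(x :: 'n \<Rightarrow> real) k l. \<kappa> * (x k - x l)\<^sup>2 \<le> (\<Sum>i\<in>UNIV. \<Sum>j\<in>UNIV. w i j * (x i - x j)\<^sup>2)"
proof -
  define Q where "Q x = (\<Sum>i\<in>UNIV. \<Sum>j\<in>UNIV. w i j * (x i - x j)\<^sup>2)" for x :: "'n \<Rightarrow> real"
  have edge: "w k l * (x k - x l)\<^sup>2 \<le> Q x" for x k l
  proof -
    have "w k l * (x k - x l)\<^sup>2 \<le> (\<Sum>j\<in>UNIV. w k j * (x k - x j)\<^sup>2)"
      by (rule member_le_sum[where f = "\<lambda>j. w k j * (x k - x j)\<^sup>2"]) (auto simp: nonneg)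
    also have "\<dots> \<le> Q x"
      unfolding Q_def
      by (rule member_le_sum[where f = "\<lambda>i. \<Sum>j\<in>UNIV. w i j * (x i - x j)\<^sup>2"])
        (auto intro!: sum_nonneg simp: nonneg)
    finally show ?thesis .
  qed
  have Q0: "0 \<le> Q x" for x by (auto simp: Q_def intro!: sum_nonneg mult_nonneg_nonneg nonneg)
  have ex: "\<exists>B>0. \<forall>x. (x k - x l)\<^sup>2 \<le> B * Q x" for k l
  proof -
    have "(k, l) \<in> {(i, j). {i, j} \<in> E}\<^sup>*" using conn by (simp add: connected_graph_def)
    then show ?thesis
    proof induction
      case base
      show ?case by (intro exI[of _ 1]) (simp add: Q0)
    next
      case (step a b)
      then obtain B where B: "B > 0" "\<And>x. (x k - x a)\<^sup>2 \<le> B * Q x" by blast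
      have wab: "0 < w a b" using step pos by auto
      \<comment> \<open>The constant comes from
        \<open>(p + q)\<^sup>2 \<le> 2 * p\<^sup>2 + 2 * q\<^sup>2\<close> applied to the last edge
        of the path.\<close>
      have "(x k - x b)\<^sup>2 \<le> (2 * B + 2 / w a b) * Q x" for x
      proof -
        have "(x a - x b)\<^sup>2 \<le> Q x / w a b" using edge[of a b x] wab by (simp add: field_simps)
        moreover have "(x k - x b)\<^sup>2 \<le> 2 * (x k - x a)\<^sup>2 + 2 * (x a - x b)\<^sup>2"
          using zero_le_power2[of "(x k - x a) - (x a - x b)"] by (simp add: power2_eq_square algebra_simps)
        moreover have "(2 * B + 2 / w a b) * Q x = 2 * (B * Q x) + 2 * (Q x / w a b)"
          by (simp add: algebra_simps)
        ultimately show ?thesis using B(2)[of x] by linarith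
      qed
      moreover have "0 < 2 * B + 2 / w a b" using B(1) wab by (simp add: add_pos_pos)
      ultimately show ?case by blast
    qed
  qed
  then obtain B where B: "\<And>k l. 0 < B k l" "\<And>k l x. (x k - x l)\<^sup>2 \<le> B k l * Q x"
    by metis
  \<comment> \<open>All \<open>B k l\<close> are positive, so their sum is a common upper
    bound.\<close>
  define T where "T = (\<Sum>k\<in>UNIV. \<Sum>l\<in>UNIV. B k l)"
  have T: "B k l \<le> T" for k l
  proof -
    have "B k l \<le> (\<Sum>l\<in>UNIV. B k l)"
      by (rule member_le_sum) (auto simp: B(1) less_imp_le)
    also have "\<dots> \<le> T"
      unfolding T_def
      by (rule member_le_sum[where f = "\<lambda>k. \<Sum>l\<in>UNIV. B k l"])
        (auto intro!: sum_nonneg simp: B(1) less_imp_le)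
    finally show ?thesis .
  qed
  then have Tpos: "0 < T" using B(1) less_le_trans by blast
  show thesis
  proof (rule that)
    show "0 < inverse T" using Tpos by simp
    fix x :: "'n \<Rightarrow> real" and k l
    have "(x k - x l)\<^sup>2 \<le> T * Q x"
      using B(2)[where k = k and l = l and x = x] mult_right_mono[OF T[of k l] Q0[of x]] by linarith
    then show "inverse T * (x k - x l)\<^sup>2 \<le> (\<Sum>i\<in>UNIV. \<Sum>j\<in>UNIV. w i j * (x i - x j)\<^sup>2)"
      using Tpos by (simp add: Q_def field_simps)
  qed
qed

section \<open>Lower bounds for the edge terms and the energy\<close>

lemma one_minus_square_ratio_pos:
  fixes c p :: real
  assumes "\<bar>c\<bar> < p"
  shows "0 < 1 - c\<^sup>2 / p\<^sup>2"
proof -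
  have "c\<^sup>2 < p\<^sup>2" using assms by (metis abs_ge_zero power2_abs power_strict_mono zero_less_numeral)
  then show ?thesis using assms by (simp add: divide_less_eq)
qed

lemma edge_term_ge:
  fixes r b c p :: real
  assumes c: "\<bar>c\<bar> < p" and b: "0 < b"
  shows "- \<bar>r\<bar> * p \<le> r * c - 1 / 2 * (b * ln (1 - c\<^sup>2 / p\<^sup>2))"
proof -
  have "- \<bar>r\<bar> * p \<le> - (\<bar>r\<bar> * \<bar>c\<bar>)" using c by (simp add: mult_left_mono)
  also have "\<dots> \<le> r * c" by (metis abs_ge_minus_self abs_mult minus_le_iff)
  finally have "- \<bar>r\<bar> * p \<le> r * c" .
  moreover have "ln (1 - c\<^sup>2 / p\<^sup>2) \<le> 0"
    using one_minus_square_ratio_pos[OF c] by simp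
  then have "b * ln (1 - c\<^sup>2 / p\<^sup>2) \<le> 0" using b by (simp add: mult_nonneg_nonpos)
  ultimately show ?thesis by linarith
qed

text \<open>Minimising over the correlation leaves a gain of \<open>b / 2 * ln p\<close> over the trivial bound.\<close>

lemma edge_term_ge_ln:
  fixes r b c p :: real
  assumes c: "\<bar>c\<bar> < p" and b: "0 < b" and r: "r \<noteq> 0"
  shows "b / 2 * (ln p - ln 2 + 1 + ln (\<bar>r\<bar> / (b / 2))) - \<bar>r\<bar> * p
    \<le> r * c - 1 / 2 * (b * ln (1 - c\<^sup>2 / p\<^sup>2))"
proof -
  have p: "0 < p" using c by linarith
  \<comment> \<open>The factor \<open>(p + \<bar>c\<bar>) / p\<close> is at most 2, so only the
    distance \<open>p - \<bar>c\<bar>\<close> to the boundary remains under the logarithm.\<close>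
  have "1 - c\<^sup>2 / p\<^sup>2 = (p - \<bar>c\<bar>) / p * ((p + \<bar>c\<bar>) / p)"
    using p by (simp add: power2_eq_square field_simps abs_mult_self_eq)
  also have "\<dots> \<le> (p - \<bar>c\<bar>) / p * 2"
    using p c by (intro mult_left_mono) (auto simp: field_simps)
  finally have "ln (1 - c\<^sup>2 / p\<^sup>2) \<le> ln ((p - \<bar>c\<bar>) / p * 2)"
    using one_minus_square_ratio_pos[OF c] p c by simp
  also have "\<dots> = ln (p - \<bar>c\<bar>) - ln p + ln 2"
    using p c by (subst ln_mult) (auto simp: ln_div)
  finally have "b / 2 * ln (1 - c\<^sup>2 / p\<^sup>2) \<le> b / 2 * (ln (p - \<bar>c\<bar>) - ln p + ln 2)"
    using b by (intro mult_left_mono) auto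
  moreover have "b / 2 * ln (p - \<bar>c\<bar>) \<le> \<bar>r\<bar> * (p - \<bar>c\<bar>) - b / 2 * (1 + ln (\<bar>r\<bar> / (b / 2)))"
    by (rule mult_ln_le) (use b c r in auto)
  moreover have "- (\<bar>r\<bar> * \<bar>c\<bar>) \<le> r * c" by (metis abs_ge_minus_self abs_mult minus_le_iff)
  ultimately show ?thesis by (simp add: algebra_simps)
qed

text \<open>Here \<open>g\<close> is a gain per edge over the trivial bound
  \<open>- \<bar>R $ i $ j\<bar> * (s $ i * s $ j)\<close>: zero in the subcritical case,
  logarithmic or zero in the critical one. The trivial bounds add up to the form of
  \<open>abs_matrix R\<close>.\<close>

lemma bethe_energy_ge:
  fixes R :: "real^'n^'n"
  assumes sym: "transpose R = R" and diag: "\<forall>i. R $ i $ i = 0"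
    and K: "K \<le> - (h \<bullet> m) + 1 / 2 * (m \<bullet> ((mat 1 + R) *v m))"
    and g: "\<And>i j. {i, j} \<in> edges R \<Longrightarrow> g i j - \<bar>R $ i $ j\<bar> * (s $ i * s $ j)
      \<le> R $ i $ j * c {i, j} - 1 / 2 * (1 / \<alpha> {i, j} * ln (1 - (c {i, j})\<^sup>2 / (s $ i * s $ j)\<^sup>2))"
  shows "K + C + (s \<bullet> s - s \<bullet> (abs_matrix R *v s)) / 2 + edge_sum (edges R) g - (\<Sum>k\<in>UNIV. ln (s $ k))
    \<le> bethe_energy h R C \<alpha> (m, s, c)"
proof -
  have "edge_sum (edges R) g - s \<bullet> (abs_matrix R *v s) / 2
    = edge_sum (edges R) (\<lambda>i j. g i j - \<bar>R $ i $ j\<bar> * (s $ i * s $ j))"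
    by (simp add: edge_sum_diff edge_sum_abs_matrix[OF sym diag])
  also have "\<dots> \<le> edge_sum (edges R) (\<lambda>i j. R $ i $ j * c {i, j}
      - 1 / 2 * (1 / \<alpha> {i, j} * ln (1 - (c {i, j})\<^sup>2 / (s $ i * s $ j)\<^sup>2)))"
    by (rule edge_sum_mono) (rule g)
  finally have "edge_sum (edges R) g - s \<bullet> (abs_matrix R *v s) / 2
    \<le> edge_sum (edges R) (\<lambda>i j. R $ i $ j * c {i, j}) - 1 / 2 * edge_sum (edges R)
         (\<lambda>i j. 1 / \<alpha> {i, j} * ln (1 - (c {i, j})\<^sup>2 / ((s $ i)\<^sup>2 * (s $ j)\<^sup>2)))"
    unfolding edge_sum_diff edge_sum_mult_left power_mult_distrib .
  moreover have "s \<bullet> s = (\<Sum>k\<in>UNIV. (s $ k)\<^sup>2)" by (simp add: inner_vec_def power2_eq_square)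
  ultimately show ?thesis unfolding bethe_energy_def prod.case using K by argo
qed

section \<open>Boundedness below and at the threshold\<close>

lemma bounded_from_below_subcritical:
  fixes R :: "real^'n^'n"
  assumes sym: "transpose R = R" and diag: "\<forall>i. R $ i $ i = 0"
    and pd: "positive_definite (mat 1 + R)" and less: "lambda_max (abs_matrix R) < 1"
    and \<alpha>: "\<And>e. e \<in> edges R \<Longrightarrow> 0 < \<alpha> e"
  shows "bounded_from_below h R C \<alpha>"
proof -
  obtain K where K: "\<And>m. K \<le> - (h \<bullet> m) + 1 / 2 * (m \<bullet> ((mat 1 + R) *v m))"
    using pos_def_quadratic_bdd_below[OF pd] by blast
  \<comment> \<open>Half the spectral gap: the energy then dominates a sum of independent terms
    \<open>a * (s $ k)\<^sup>2 - ln (s $ k)\<close>, up to a constant.\<close>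
  define a where "a = (1 - lambda_max (abs_matrix R)) / 2"
  have "0 < a" using less by (simp add: a_def)
  then obtain L where L: "\<And>x. 0 < x \<Longrightarrow> L \<le> a * x\<^sup>2 - 1 * ln x"
    using square_minus_ln_bdd_below[of a 1] by auto
  have "K + C + real CARD('n) * L \<le> bethe_energy h R C \<alpha> (m, s, c)"
    if dom: "(m, s, c) \<in> bethe_domain R" for m s c
  proof -
    have "real CARD('n) * L = (\<Sum>k\<in>(UNIV::'n set). L)" by simp
    also have "\<dots> \<le> (\<Sum>k\<in>UNIV. a * (s $ k)\<^sup>2 - ln (s $ k))"
      using dom L by (intro sum_mono) (auto simp: bethe_domain_def)
    also have "\<dots> = a * (s \<bullet> s) - (\<Sum>k\<in>UNIV. ln (s $ k))"
      by (simp add: sum_subtractf sum_distrib_left[symmetric] inner_vec_def power2_eq_square)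
    also have "a * (s \<bullet> s) \<le> (s \<bullet> s - s \<bullet> (abs_matrix R *v s)) / 2"
      using rayleigh_le_lambda_max[OF transpose_abs_matrix[OF sym], of s]
      by (simp add: a_def field_simps)
    finally have "K + C + real CARD('n) * L \<le> K + C + (s \<bullet> s - s \<bullet> (abs_matrix R *v s)) / 2
      + edge_sum (edges R) (\<lambda>i j. 0) - (\<Sum>k\<in>UNIV. ln (s $ k))"
      by (simp add: edge_sum_def)
    also have "\<dots> \<le> bethe_energy h R C \<alpha> (m, s, c)"
    proof (rule bethe_energy_ge[OF sym diag K])
      fix i j assume e: "{i, j} \<in> edges R"
      have "\<bar>c {i, j}\<bar> < s $ i * s $ j" "0 < 1 / \<alpha> {i, j}"
        using dom e \<alpha>[OF e] by (auto simp: bethe_domain_def)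
      from edge_term_ge[OF this, of "R $ i $ j"]
      show "0 - \<bar>R $ i $ j\<bar> * (s $ i * s $ j) \<le> R $ i $ j * c {i, j}
        - 1 / 2 * (1 / \<alpha> {i, j} * ln (1 - (c {i, j})\<^sup>2 / (s $ i * s $ j)\<^sup>2))"
        by simp
    qed
    finally show ?thesis .
  qed
  then show ?thesis unfolding bounded_from_below_def
    by (intro bdd_belowI[of _ "K + C + real CARD('n) * L"]) auto
qed

text \<open>In the application \<open>M\<close> and \<open>d\<close> are the largest and smallest
  ratio \<open>s $ i / u $ i\<close>, and \<open>E\<close> is the total edge gain. For
  \<open>M \<le> 1\<close> the logarithm does no harm; for \<open>d\<close> comparable to
  \<open>M\<close> the gain absorbs it because \<open>N \<le> B\<close>; otherwise the square
  dominates.\<close>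

lemma critical_scalar_bound:
  fixes \<kappa> B K N :: real
  assumes "0 < \<kappa>" "0 < N" "N \<le> B"
  obtains L where "\<And>M d E. \<lbrakk>0 < d; d \<le> M; 0 \<le> E; B * ln d - K \<le> E\<rbrakk>
    \<Longrightarrow> L \<le> \<kappa> * (M - d)\<^sup>2 + E - N * ln M"
proof -
  obtain L where L: "\<And>x. 0 < x \<Longrightarrow> L \<le> \<kappa> / 4 * x\<^sup>2 - N * ln x"
    using square_minus_ln_bdd_below[of "\<kappa> / 4" N] assms by auto
  define L' where "L' = min 0 (min L (- (B * ln 2) - K))"
  show thesis
  proof (rule that)
    fix M d E :: real
    assume d: "0 < d" and dM: "d \<le> M" and E0: "0 \<le> E" and E: "B * ln d - K \<le> E"
    have M: "0 < M" using d dM by linarith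
    have sq: "0 \<le> \<kappa> * (M - d)\<^sup>2" using assms by simp
    consider "M \<le> 1" | "1 < M" "M / 2 \<le> d" | "d < M / 2" by linarith
    then show "L' \<le> \<kappa> * (M - d)\<^sup>2 + E - N * ln M"
    proof cases
      case 1
      then have "N * ln M \<le> 0" using M assms by (simp add: mult_nonneg_nonpos)
      then show ?thesis using sq E0 by (simp add: L'_def)
    next
      case 2
      have "ln (M / 2) \<le> ln d" using 2 M d by simp
      then have "B * (ln M - ln 2) \<le> B * ln d"
        using assms M by (intro mult_left_mono) (auto simp: ln_div)
      moreover have "N * ln M \<le> B * ln M" using assms 2 by (intro mult_right_mono) auto
      ultimately show ?thesis using sq E by (simp add: L'_def algebra_simps)
    next
      case 3
      have "(M / 2)\<^sup>2 \<le> (M - d)\<^sup>2" using 3 M by (intro power_mono) auto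
      then have "\<kappa> * (M / 2)\<^sup>2 \<le> \<kappa> * (M - d)\<^sup>2" using assms by simp
      then show ?thesis using L[OF M] E0 by (simp add: L'_def power_divide)
    qed
  qed
qed

lemma bounded_from_below_critical:
  fixes R :: "real^'n^'n"
  assumes sym: "transpose R = R" and diag: "\<forall>i. R $ i $ i = 0"
    and conn: "connected_graph (edges R)"
    and pd: "positive_definite (mat 1 + R)" and one: "lambda_max (abs_matrix R) = 1"
    and \<alpha>: "\<And>e. e \<in> edges R \<Longrightarrow> 0 < \<alpha> e"
    and B: "real CARD('n) \<le> edge_sum (edges R) (\<lambda>i j. 1 / \<alpha> {i, j})"
  shows "bounded_from_below h R C \<alpha>"
proof -
  let ?A = "abs_matrix R" and ?B = "edge_sum (edges R) (\<lambda>i j. 1 / \<alpha> {i, j})"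
  obtain u where u: "\<And>i. 0 < u $ i" and Au: "?A *v u = u"
    using perron_vector[OF sym diag conn one] by blast
  define w where "w i j = ?A $ i $ j * (u $ i * u $ j)" for i j
  have w0: "0 \<le> w i j" for i j
    using u[of i] u[of j] by (auto simp: w_def abs_matrix_def intro!: mult_nonneg_nonneg)
  have wpos: "0 < w i j" if "{i, j} \<in> edges R" for i j
    using that u[of i] u[of j]
    by (auto simp: w_def abs_matrix_def mem_edges_iff[OF sym diag] intro!: mult_pos_pos)
  obtain \<kappa> where \<kappa>: "0 < \<kappa>" and poin: "\<And>(x :: 'n \<Rightarrow> real) k l.
      \<kappa> * (x k - x l)\<^sup>2 \<le> (\<Sum>i\<in>UNIV. \<Sum>j\<in>UNIV. w i j * (x i - x j)\<^sup>2)"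
    by (rule graph_poincare[where w = w, OF conn]) (use w0 wpos in auto)
  obtain K where K: "\<And>m. K \<le> - (h \<bullet> m) + 1 / 2 * (m \<bullet> ((mat 1 + R) *v m))"
    using pos_def_quadratic_bdd_below[OF pd] by blast
  \<comment> \<open>The part of the bound \<open>edge_term_ge_ln\<close> free of \<open>s\<close>,
    once both ratios in \<open>s $ i * s $ j\<close> are replaced by the smallest one.\<close>
  define q where "q i j = 1 / \<alpha> {i, j} / 2 *
    (ln (u $ i) + ln (u $ j) - ln 2 + 1 + ln (\<bar>R $ i $ j\<bar> / (1 / \<alpha> {i, j} / 2)))" for i j
  define K1 where "K1 = - edge_sum (edges R) q"
  \<comment> \<open>One half in \<open>\<kappa> / 4\<close> comes from the energy, the other from
    \<open>ground_state_identity\<close>.\<close>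
  obtain L where L: "\<And>M d E. \<lbrakk>0 < d; d \<le> M; 0 \<le> E; ?B * ln d - K1 \<le> E\<rbrakk>
      \<Longrightarrow> L \<le> \<kappa> / 4 * (M - d)\<^sup>2 + E - real CARD('n) * ln M"
    using critical_scalar_bound[of "\<kappa> / 4" "real CARD('n)" ?B K1] \<kappa> B by auto
  define b where "b = K + C + L - (\<Sum>k\<in>UNIV. ln (u $ k))"
  have "b \<le> bethe_energy h R C \<alpha> (m, s, c)" if dom: "(m, s, c) \<in> bethe_domain R" for m s c
  proof -
    have s: "0 < s $ k" for k using dom by (simp add: bethe_domain_def)
    have c: "\<bar>c {i, j}\<bar> < s $ i * s $ j" if "{i, j} \<in> edges R" for i j
      using dom that by (simp add: bethe_domain_def)
    define x where "x i = s $ i / u $ i" for i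
    have x: "0 < x i" for i using s u by (simp add: x_def)
    have lns: "ln (s $ i) = ln (x i) + ln (u $ i)" for i
      using s[of i] u[of i] by (simp add: x_def ln_div)
    have "Max (range x) \<in> range x" "Min (range x) \<in> range x" by simp_all
    then obtain k l where k: "\<And>i. x i \<le> x k" and l: "\<And>i. x l \<le> x i"
      by (metis Max_ge Min_le finite_imageI finite rangeE rangeI)
    \<comment> \<open>The maximum on each edge makes the total gain both nonnegative and at least
      \<open>?B * ln (x l) - K1\<close>, as the scalar bound requires.\<close>
    define g where "g i j = max 0 (1 / \<alpha> {i, j} * ln (x l) + q i j)" for i j
    let ?E = "edge_sum (edges R) g"
    have "edge_sum (edges R) (\<lambda>i j. 0) \<le> ?E" by (rule edge_sum_mono) (simp add: g_def)
    then have E0: "0 \<le> ?E" by (simp add: edge_sum_def)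
    have "edge_sum (edges R) (\<lambda>i j. 1 / \<alpha> {i, j} * ln (x l) + q i j) \<le> ?E"
      by (rule edge_sum_mono) (simp add: g_def)
    then have E1: "?B * ln (x l) - K1 \<le> ?E"
      unfolding edge_sum_add edge_sum_mult_right K1_def by simp
    have "L \<le> \<kappa> / 4 * (x k - x l)\<^sup>2 + ?E - real CARD('n) * ln (x k)"
      by (rule L[OF x k E0 E1])
    moreover have "\<kappa> / 4 * (x k - x l)\<^sup>2 \<le> (s \<bullet> s - s \<bullet> (?A *v s)) / 2"
      using poin[of x k l] \<kappa>
      unfolding ground_state_identity[OF transpose_abs_matrix[OF sym] u Au] w_def x_def
      by (simp add: zero_le_mult_iff)
    moreover have "(\<Sum>i\<in>UNIV. ln (s $ i)) \<le> real CARD('n) * ln (x k) + (\<Sum>k\<in>UNIV. ln (u $ k))"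
      unfolding lns sum.distrib using sum_bounded_above[of UNIV "\<lambda>i. ln (x i)" "ln (x k)"] k x
      by simp
    ultimately have "b \<le> K + C + (s \<bullet> s - s \<bullet> (?A *v s)) / 2 + ?E - (\<Sum>k\<in>UNIV. ln (s $ k))"
      unfolding b_def by linarith
    also have "\<dots> \<le> bethe_energy h R C \<alpha> (m, s, c)"
    proof (rule bethe_energy_ge[OF sym diag K])
      fix i j assume e: "{i, j} \<in> edges R"
      have \<beta>: "0 < 1 / \<alpha> {i, j}" using \<alpha>[OF e] by simp
      have r: "R $ i $ j \<noteq> 0" using e by (simp add: mem_edges_iff[OF sym diag])
      have "ln (s $ i * s $ j) = ln (x i) + ln (x j) + ln (u $ i) + ln (u $ j)"
        using s[of i] s[of j] by (simp add: ln_mult lns)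
      moreover have "ln (x l) \<le> ln (x i)" "ln (x l) \<le> ln (x j)" using l x by simp_all
      ultimately have "2 * ln (x l) + ln (u $ i) + ln (u $ j) \<le> ln (s $ i * s $ j)" by linarith
      then have "1 / \<alpha> {i, j} / 2 * (2 * ln (x l) + ln (u $ i) + ln (u $ j)
          - ln 2 + 1 + ln (\<bar>R $ i $ j\<bar> / (1 / \<alpha> {i, j} / 2)))
        \<le> 1 / \<alpha> {i, j} / 2 * (ln (s $ i * s $ j)
          - ln 2 + 1 + ln (\<bar>R $ i $ j\<bar> / (1 / \<alpha> {i, j} / 2)))"
        using \<beta> by (intro mult_left_mono) auto
      moreover have "1 / \<alpha> {i, j} / 2 * (2 * ln (x l) + ln (u $ i) + ln (u $ j)
          - ln 2 + 1 + ln (\<bar>R $ i $ j\<bar> / (1 / \<alpha> {i, j} / 2))) = 1 / \<alpha> {i, j} * ln (x l) + q i j"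
        unfolding q_def by (simp only: ring_distribs) simp
      ultimately show "g i j - \<bar>R $ i $ j\<bar> * (s $ i * s $ j) \<le> R $ i $ j * c {i, j}
        - 1 / 2 * (1 / \<alpha> {i, j} * ln (1 - (c {i, j})\<^sup>2 / (s $ i * s $ j)\<^sup>2))"
        using edge_term_ge[OF c[OF e] \<beta>, of "R $ i $ j"] edge_term_ge_ln[OF c[OF e] \<beta> r]
        unfolding g_def by linarith
    qed
    finally show ?thesis .
  qed
  then show ?thesis unfolding bounded_from_below_def by (intro bdd_belowI[of _ b]) auto
qed

section \<open>Test points and unboundedness\<close>

text \<open>Every correlation has size \<open>1 - \<delta>\<close> and sign opposite to
  \<open>R $ i $ j\<close>; a positive \<delta> keeps the point strictly inside the domain, and the
  zero mean removes \<open>h\<close>.\<close>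

lemma bethe_energy_test_point:
  fixes R :: "real^'n^'n"
  assumes sym: "transpose R = R" and diag: "\<forall>i. R $ i $ i = 0"
    and s: "\<And>k. 0 < s $ k" and \<delta>: "0 < \<delta>" "\<delta> \<le> 1"
  obtains c where "(0, s, c) \<in> bethe_domain R"
    "bethe_energy h R C \<alpha> (0, s, c) = (s \<bullet> s - (1 - \<delta>) * (s \<bullet> (abs_matrix R *v s))) / 2
      - 1 / 2 * (edge_sum (edges R) (\<lambda>i j. 1 / \<alpha> {i, j}) * ln (1 - (1 - \<delta>)\<^sup>2))
      - (\<Sum>k\<in>UNIV. ln (s $ k)) + C"
proof -
  have symR: "R $ i $ j = R $ j $ i" for i j
    by (rule symmetric_matrix_entry[OF sym])
  \<comment> \<open>As a function of the unordered edge: over \<open>{i, j}\<close> the double sum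
    is \<open>2 * R $ i $ j\<close>, which has the right sign, and the product is
    \<open>s $ i * s $ j\<close>.\<close>
  define c where "c e = - (1 - \<delta>) * sgn (\<Sum>i\<in>e. \<Sum>j\<in>e. R $ i $ j) * (\<Prod>k\<in>e. s $ k)" for e
  have c: "c {i, j} = - (1 - \<delta>) * sgn (R $ i $ j) * (s $ i * s $ j)" if "{i, j} \<in> edges R" for i j
  proof -
    have "i \<noteq> j" using that diag by (auto simp: mem_edges_iff[OF sym diag])
    moreover have "sgn (2 * R $ i $ j) = sgn (R $ i $ j)" by (simp add: sgn_mult)
    ultimately show ?thesis using diag by (simp add: c_def symR[of j i])
  qed
  have sg: "\<bar>sgn (R $ i $ j)\<bar> = 1" if "{i, j} \<in> edges R" for i j
    using that by (simp add: mem_edges_iff[OF sym diag] abs_sgn_eq)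
  have p: "0 < s $ i * s $ j" for i j using s by simp
  have abs: "\<bar>c {i, j}\<bar> = (1 - \<delta>) * (s $ i * s $ j)" if "{i, j} \<in> edges R" for i j
    unfolding c[OF that] abs_mult sg[OF that] abs_of_pos[OF s] using \<delta> by simp
  have sq: "(c {i, j})\<^sup>2 / ((s $ i)\<^sup>2 * (s $ j)\<^sup>2) = (1 - \<delta>)\<^sup>2" if "{i, j} \<in> edges R" for i j
  proof -
    have "(c {i, j})\<^sup>2 = (1 - \<delta>)\<^sup>2 * ((s $ i)\<^sup>2 * (s $ j)\<^sup>2)"
      using abs[OF that] by (metis power2_abs power_mult_distrib)
    then show ?thesis using s[of i] s[of j] by simp
  qed
  show thesis
  proof (rule that)
    show "(0, s, c) \<in> bethe_domain R"
      using s \<delta> p by (auto simp: bethe_domain_def abs mult_less_cancel_right1)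
    have "edge_sum (edges R) (\<lambda>i j. R $ i $ j * c {i, j})
      = edge_sum (edges R) (\<lambda>i j. - (1 - \<delta>) * (\<bar>R $ i $ j\<bar> * (s $ i * s $ j)))"
    proof (rule edge_sum_cong)
      fix i j assume e: "{i, j} \<in> edges R"
      show "R $ i $ j * c {i, j} = - (1 - \<delta>) * (\<bar>R $ i $ j\<bar> * (s $ i * s $ j))"
        unfolding c[OF e] abs_sgn[of "R $ i $ j"] by (simp only: mult_ac)
    qed
    also have "\<dots> = - (1 - \<delta>) * (s \<bullet> (abs_matrix R *v s) / 2)"
      unfolding edge_sum_mult_left edge_sum_abs_matrix[OF sym diag] ..
    finally have 1: "edge_sum (edges R) (\<lambda>i j. R $ i $ j * c {i, j})
      = - (1 - \<delta>) * (s \<bullet> (abs_matrix R *v s) / 2)" .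
    have 2: "edge_sum (edges R)
         (\<lambda>i j. 1 / \<alpha> {i, j} * ln (1 - (c {i, j})\<^sup>2 / ((s $ i)\<^sup>2 * (s $ j)\<^sup>2)))
      = edge_sum (edges R) (\<lambda>i j. 1 / \<alpha> {i, j}) * ln (1 - (1 - \<delta>)\<^sup>2)"
      unfolding edge_sum_mult_right[symmetric] by (rule edge_sum_cong) (simp add: sq)
    have 3: "(\<Sum>k\<in>UNIV. (s $ k)\<^sup>2) = s \<bullet> s" by (simp add: inner_vec_def power2_eq_square)
    show "bethe_energy h R C \<alpha> (0, s, c) = (s \<bullet> s - (1 - \<delta>) * (s \<bullet> (abs_matrix R *v s))) / 2
      - 1 / 2 * (edge_sum (edges R) (\<lambda>i j. 1 / \<alpha> {i, j}) * ln (1 - (1 - \<delta>)\<^sup>2))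
      - (\<Sum>k\<in>UNIV. ln (s $ k)) + C"
      unfolding bethe_energy_def prod.case 1 2 3 by (simp add: field_simps)
  qed
qed

text \<open>Evaluates the test points at \<open>s = t *\<^sub>R w\<close>. The constant is uniform
  in \<open>t\<close> and \<open>\<delta>\<close>, so \<open>\<delta>\<close> may later depend on
  \<open>t\<close>.\<close>

lemma bounded_from_below_ray:
  fixes R :: "real^'n^'n"
  assumes sym: "transpose R = R" and diag: "\<forall>i. R $ i $ i = 0"
    and bdd: "bounded_from_below h R C \<alpha>" and w: "\<And>k. 0 < w $ k"
  obtains L where "\<And>t \<delta>. \<lbrakk>0 < t; 0 < \<delta>; \<delta> \<le> 1\<rbrakk> \<Longrightarrow>
    L \<le> t\<^sup>2 * ((w \<bullet> w - (1 - \<delta>) * (w \<bullet> (abs_matrix R *v w))) / 2)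
      - 1 / 2 * (edge_sum (edges R) (\<lambda>i j. 1 / \<alpha> {i, j}) * ln (1 - (1 - \<delta>)\<^sup>2))
      - real CARD('n) * ln t"
proof -
  obtain b where b: "\<And>p. p \<in> bethe_domain R \<Longrightarrow> b \<le> bethe_energy h R C \<alpha> p"
    using bdd by (auto simp: bounded_from_below_def bdd_below_def)
  show thesis
  proof (rule that)
    fix t \<delta> :: real assume t: "0 < t" and \<delta>: "0 < \<delta>" "\<delta> \<le> 1"
    define s where "s = t *\<^sub>R w"
    have s: "0 < s $ k" for k using w t by (simp add: s_def)
    obtain c where c: "(0, s, c) \<in> bethe_domain R"
      "bethe_energy h R C \<alpha> (0, s, c) = (s \<bullet> s - (1 - \<delta>) * (s \<bullet> (abs_matrix R *v s))) / 2
      - 1 / 2 * (edge_sum (edges R) (\<lambda>i j. 1 / \<alpha> {i, j}) * ln (1 - (1 - \<delta>)\<^sup>2))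
      - (\<Sum>k\<in>UNIV. ln (s $ k)) + C"
      using bethe_energy_test_point[OF sym diag s \<delta>] by blast
    have "(\<Sum>k\<in>UNIV. ln (s $ k)) = real CARD('n) * ln t + (\<Sum>k\<in>UNIV. ln (w $ k))"
    proof -
      have "ln (s $ k) = ln t + ln (w $ k)" for k using w[of k] t by (simp add: s_def ln_mult)
      then show ?thesis by (simp add: sum.distrib)
    qed
    moreover have "(s \<bullet> s - (1 - \<delta>) * (s \<bullet> (abs_matrix R *v s))) / 2
      = t\<^sup>2 * ((w \<bullet> w - (1 - \<delta>) * (w \<bullet> (abs_matrix R *v w))) / 2)"
      by (simp add: s_def matrix_vector_mult_scaleR power2_eq_square field_simps)
    ultimately show "b + (\<Sum>k\<in>UNIV. ln (w $ k)) - C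
      \<le> t\<^sup>2 * ((w \<bullet> w - (1 - \<delta>) * (w \<bullet> (abs_matrix R *v w))) / 2)
      - 1 / 2 * (edge_sum (edges R) (\<lambda>i j. 1 / \<alpha> {i, j}) * ln (1 - (1 - \<delta>)\<^sup>2))
      - real CARD('n) * ln t"
      using b[OF c(1)] c(2) by linarith
  qed
qed

lemma unbounded_supercritical:
  fixes R :: "real^'n^'n"
  assumes sym: "transpose R = R" and diag: "\<forall>i. R $ i $ i = 0"
    and gt: "1 < lambda_max (abs_matrix R)"
  shows "\<not> bounded_from_below h R C \<alpha>"
proof
  let ?A = "abs_matrix R" and ?B = "edge_sum (edges R) (\<lambda>i j. 1 / \<alpha> {i, j})"
  assume bdd: "bounded_from_below h R C \<alpha>"
  obtain v where v: "v \<noteq> 0" "\<And>i. 0 \<le> v $ i" "v \<bullet> (?A *v v) = lambda_max ?A * (v \<bullet> v)"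
    by (rule nonneg_top_vector[OF transpose_abs_matrix[OF sym]]) (auto simp: abs_matrix_def)
  define o1 :: "real^'n" where "o1 = (\<chi> i. 1)"
  \<comment> \<open>Adding \<open>\<epsilon> *\<^sub>R o1\<close> makes the nonnegative
    \<open>v\<close> strictly positive, and the same \<open>\<epsilon>\<close> serves as
    \<open>\<delta>\<close>. At 0 the value is \<open>(1 - lambda_max ?A) * (v \<bullet> v)\<close>,
    so by continuity \<open>f\<close> stays negative for small \<open>\<epsilon>\<close>.\<close>
  define f where "f \<epsilon> = (v + \<epsilon> *\<^sub>R o1) \<bullet> (v + \<epsilon> *\<^sub>R o1)
    - (1 - \<epsilon>) * ((v + \<epsilon> *\<^sub>R o1) \<bullet> (?A *v v + \<epsilon> *\<^sub>R (?A *v o1)))" for \<epsilon> :: real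
  have "(f \<longlongrightarrow> f 0) (at_right 0)"
    unfolding f_def by (intro tendsto_intros)
  moreover have "f 0 < 0" using v(1) gt by (simp add: f_def v(3))
  ultimately have "eventually (\<lambda>\<epsilon>. f \<epsilon> < 0) (at_right 0)" by (rule order_tendstoD)
  moreover have "eventually (\<lambda>\<epsilon>::real. \<epsilon> \<in> {0<..<1}) (at_right 0)"
    by (rule eventually_at_right_real) simp
  ultimately have "eventually (\<lambda>\<epsilon>. f \<epsilon> < 0 \<and> \<epsilon> \<in> {0<..<1}) (at_right 0)"
    by (rule eventually_conj)
  then obtain \<epsilon> where \<epsilon>: "f \<epsilon> < 0" "0 < \<epsilon>" "\<epsilon> < 1"
    using eventually_happens'[OF trivial_limit_at_right_real] by fastforce
  define w where "w = v + \<epsilon> *\<^sub>R o1"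
  have "0 < w $ k" for k using v(2)[of k] \<epsilon> by (simp add: w_def o1_def add_nonneg_pos)
  then obtain L where L: "\<And>t \<delta>. \<lbrakk>0 < t; 0 < \<delta>; \<delta> \<le> 1\<rbrakk> \<Longrightarrow>
    L \<le> t\<^sup>2 * ((w \<bullet> w - (1 - \<delta>) * (w \<bullet> (?A *v w))) / 2)
      - 1 / 2 * (?B * ln (1 - (1 - \<delta>)\<^sup>2)) - real CARD('n) * ln t"
    using bounded_from_below_ray[OF sym diag bdd] by blast
  define a where "a = - f \<epsilon> / 2"
  have a: "0 < a" using \<epsilon> by (simp add: a_def)
  define D where "D = L + 1 / 2 * (?B * ln (1 - (1 - \<epsilon>)\<^sup>2))"
  have q: "(w \<bullet> w - (1 - \<epsilon>) * (w \<bullet> (?A *v w))) / 2 = - a"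
  proof -
    have "f \<epsilon> = w \<bullet> w - (1 - \<epsilon>) * (w \<bullet> (?A *v w))"
      by (simp add: f_def w_def matrix_vector_right_distrib matrix_vector_mult_scaleR)
    then show ?thesis by (simp only: a_def minus_divide_left minus_minus)
  qed
  have "D \<le> - (a * t)" if "1 \<le> t" for t
  proof -
    have "a * t \<le> a * t\<^sup>2" using a that by (simp add: power2_eq_square)
    moreover have "0 \<le> real CARD('n) * ln t" using that by simp
    moreover have "L \<le> - (a * t\<^sup>2) - 1 / 2 * (?B * ln (1 - (1 - \<epsilon>)\<^sup>2)) - real CARD('n) * ln t"
      using L[of t \<epsilon>] \<epsilon> that unfolding q by (simp add: mult.commute)
    ultimately show ?thesis unfolding D_def by argo
  qed
  \<comment> \<open>At this \<open>t\<close> the product \<open>a * t\<close> is at least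
    \<open>\<bar>D\<bar> + 1\<close>, yet at most \<open>- D\<close>.\<close>
  from this[of "max 1 ((\<bar>D\<bar> + 1) / a)"] have "a * max 1 ((\<bar>D\<bar> + 1) / a) \<le> - D" by simp
  moreover have "a * ((\<bar>D\<bar> + 1) / a) \<le> a * max 1 ((\<bar>D\<bar> + 1) / a)"
    using a by (intro mult_left_mono) auto
  ultimately show False using a by simp
qed

text \<open>On the Perron ray the quadratic part is
  \<open>t\<^sup>2 * \<delta> * (u \<bullet> u) / 2\<close>. With \<open>t = exp y\<close> and
  \<open>\<delta> = exp (- 2 * y)\<close> it stays constant, and the logarithms contribute at most
  \<open>(?B - N) * y\<close>, where \<open>N\<close> is the number of vertices.\<close>

lemma critical_bounded_imp:
  fixes R :: "real^'n^'n"
  assumes sym: "transpose R = R" and diag: "\<forall>i. R $ i $ i = 0"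
    and conn: "connected_graph (edges R)" and one: "lambda_max (abs_matrix R) = 1"
    and \<alpha>: "\<And>e. e \<in> edges R \<Longrightarrow> 0 < \<alpha> e" and bdd: "bounded_from_below h R C \<alpha>"
  shows "real CARD('n) \<le> edge_sum (edges R) (\<lambda>i j. 1 / \<alpha> {i, j})"
proof (rule ccontr)
  let ?A = "abs_matrix R" and ?B = "edge_sum (edges R) (\<lambda>i j. 1 / \<alpha> {i, j})"
  assume "\<not> ?thesis"
  then have a: "0 < real CARD('n) - ?B" by simp
  have "edge_sum (edges R) (\<lambda>i j. 0) \<le> ?B"
    by (rule edge_sum_mono) (simp add: \<alpha> less_imp_le)
  then have B0: "0 \<le> ?B" by (simp add: edge_sum_def)
  obtain u where u: "\<And>i. 0 < u $ i" and Au: "?A *v u = u"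
    using perron_vector[OF sym diag conn one] by blast
  obtain L where L: "\<And>t \<delta>. \<lbrakk>0 < t; 0 < \<delta>; \<delta> \<le> 1\<rbrakk> \<Longrightarrow>
    L \<le> t\<^sup>2 * ((u \<bullet> u - (1 - \<delta>) * (u \<bullet> (?A *v u))) / 2)
      - 1 / 2 * (?B * ln (1 - (1 - \<delta>)\<^sup>2)) - real CARD('n) * ln t"
    using bounded_from_below_ray[OF sym diag bdd u] by blast
  have bound: "L - u \<bullet> u / 2 \<le> - ((real CARD('n) - ?B) * y)" if y: "0 \<le> y" for y
  proof -
    define \<delta> where "\<delta> = exp (- 2 * y)"
    have \<delta>: "0 < \<delta>" "\<delta> \<le> 1" using y by (simp_all add: \<delta>_def)
    have t\<delta>: "(exp y)\<^sup>2 * \<delta> = 1"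
      by (simp add: \<delta>_def power2_eq_square exp_add[symmetric])
    \<comment> \<open>The right side is \<open>\<delta> * (2 - \<delta>)\<close>, so its logarithm
      is at least \<open>- 2 * y\<close>.\<close>
    have "\<delta> \<le> 1 - (1 - \<delta>)\<^sup>2"
      using mult_left_mono[OF \<delta>(2), of \<delta>] \<delta> by (simp add: power2_eq_square algebra_simps)
    then have "ln \<delta> \<le> ln (1 - (1 - \<delta>)\<^sup>2)" using \<delta> by simp
    then have "?B * (- 2 * y) \<le> ?B * ln (1 - (1 - \<delta>)\<^sup>2)"
      using B0 by (intro mult_left_mono) (simp_all add: \<delta>_def)
    moreover have "(exp y)\<^sup>2 * ((u \<bullet> u - (1 - \<delta>) * (u \<bullet> (?A *v u))) / 2)
      = (exp y)\<^sup>2 * \<delta> * (u \<bullet> u) / 2"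
      by (simp add: Au algebra_simps)
    ultimately show ?thesis
      using L[of "exp y" \<delta>] \<delta> unfolding t\<delta> by (simp add: algebra_simps)
  qed
  let ?D = "L - u \<bullet> u / 2"
  \<comment> \<open>The argument \<open>y\<close> is chosen so that the right side of
    \<open>bound\<close> becomes \<open>- (\<bar>?D\<bar> + 1)\<close>.\<close>
  have "?D \<le> - (\<bar>?D\<bar> + 1)"
    using bound[of "(\<bar>?D\<bar> + 1) / (real CARD('n) - ?B)"] a by simp
  then show False by linarith
qed

theorem mainTheorem1:
  fixes J R :: "real^'n^'n" and h :: "real^'n" and C :: real
  assumes "J = mat 1 + R"
    and "positive_definite J"
    and "\<forall>i. R $ i $ i = 0"
    and "connected_graph (edges R)"
  shows "(lambda_max (abs_matrix R) < 1 \<longrightarrow>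
           (\<forall>\<alpha>. (\<forall>e\<in>edges R. 0 < \<alpha> e) \<longrightarrow> bounded_from_below h R C \<alpha>)) \<and>
         (lambda_max (abs_matrix R) > 1 \<longrightarrow>
           (\<forall>\<alpha>. (\<forall>e\<in>edges R. 0 < \<alpha> e) \<longrightarrow> \<not> bounded_from_below h R C \<alpha>)) \<and>
         (lambda_max (abs_matrix R) = 1 \<longrightarrow>
           (\<forall>\<alpha>. (\<forall>e\<in>edges R. 0 < \<alpha> e) \<longrightarrow>
             (bounded_from_below h R C \<alpha> \<longleftrightarrow>
              1 / 2 * (\<Sum>i\<in>UNIV. \<Sum>j | {i, j} \<in> edges R. 1 / \<alpha> {i, j}) \<ge> real CARD('n))))"
proof -
  have pd: "positive_definite (mat 1 + R)" using assms(1,2) by simp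
  then have "transpose (mat 1 + R) = mat 1 + R" by (simp add: positive_definite_def)
  note entry = symmetric_matrix_entry[OF this]
  \<comment> \<open>The symmetry of \<open>R\<close> is inherited from \<open>J\<close>, since the
    identity has no off-diagonal entries.\<close>
  have "R $ i $ j = R $ j $ i" for i j
    using entry[of i j] by (cases "i = j") (simp_all add: mat_def)
  then have sym: "transpose R = R" by (simp add: transpose_def vec_eq_iff)
  have B: "1 / 2 * (\<Sum>i\<in>UNIV. \<Sum>j | {i, j} \<in> edges R. 1 / \<alpha> {i, j})
    = edge_sum (edges R) (\<lambda>i j. 1 / \<alpha> {i, j})" for \<alpha> :: "'n set \<Rightarrow> real"
    by (simp add: edge_sum_def)
  show ?thesis
    unfolding B
    using bounded_from_below_subcritical[OF sym assms(3) pd, of _ h C]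
      unbounded_supercritical[OF sym assms(3), of h C]
      bounded_from_below_critical[OF sym assms(3,4) pd, of _ h C]
      critical_bounded_imp[OF sym assms(3,4), of _ h C]
    by blast
qed

end
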